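(* Let $L=(L,\le)$ be a finite lattice. A subset $X\subseteq L$ is c-independent if and only if $X$ is a partial cross section of the partition $\mathcal{Q}$ associated with some maximal chain of $L$ from the top element $T$ to the bottom element $B$.
   Context: The superboolean semiring is $\mathbb{SB}=\{0,1,1^\nu\}$ with commutative operations: $0+x=x$ for all $x$, $1+1=1+1^\nu=1^\nu+1^\nu=1^\nu$; $0\cdot x=0$, $1\cdot x=x$, $1^\nu\cdot 1^\nu=1^\nu$. Vectors $v_1,\dots,v_m\in\mathbb{SB}^{n}$ are dependent if there are $\alpha_1,\dots,\alpha_m\in\{0,1\}$, not all $0$, with $\alpha_1v_1+\cdots+\alpha_mv_m\in\{0,1^\nu\}^{n}$; otherwise they are independent. For a finite lattice $L$ let $D$ be the matrix over $\mathbb{SB}$ with rows and columns indexed by $L$, whose entry in row $m$ and column $\ell$ is $1$ if $\ell\not\le m$ and $0$ if $\ell\le m$. A subset $X\subseteq L$ is c-independent if the columns of $D$ indexed by $X$ are independent. For $p\in L$ put $\downarrow p=\{x\in L: x\le p\}$. Given a maximal strict chain $T=p_0>p_1>\cdots>p_k=B$ in $L$, the associated partition is $\mathcal{Q}=(Q_1,\dots,Q_k)$ with $Q_i:=\downarrow p_{i-1}\setminus\downarrow p_i$; these sets are disjoint with union $L\setminus\{B\}$. A subset $X\subseteq L$ is a partial cross section of $\mathcal{Q}$ if each $x\in X$ lies in some $Q_i$ and distinct elements of $X$ lie in distinct $Q_i$'s. *)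

theory Defs
  imports "HOL-Analysis.Analysis"
begin

text \<open>The superboolean semiring; \<open>SBnu\<close> is the ghost element $1^\nu$.\<close>

datatype superboolean = SB0 | SB1 | SBnu

instantiation superboolean :: comm_semiring_1
begin

definition zero_superboolean :: superboolean where "0 = SB0"

definition one_superboolean :: superboolean where "1 = SB1"

fun plus_superboolean :: "superboolean \<Rightarrow> superboolean \<Rightarrow> superboolean" where
  "SB0 + x = x"
| "x + SB0 = x"
| "_ + _ = SBnu"

fun times_superboolean :: "superboolean \<Rightarrow> superboolean \<Rightarrow> superboolean" where
  "SB0 * _ = SB0"
| "_ * SB0 = SB0"
| "SB1 * x = x"
| "x * SB1 = x"
| "SBnu * SBnu = SBnu"

instance
proof
  fix a b c :: superboolean
  show "a + b + c = a + (b + c)" by (cases a; cases b; cases c) simp_all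
  show "a + b = b + a" by (cases a; cases b) simp_all
  show "0 + a = a" by (simp add: zero_superboolean_def)
  show "a * b * c = a * (b * c)" by (cases a; cases b; cases c) simp_all
  show "a * b = b * a" by (cases a; cases b) simp_all
  show "1 * a = a" by (cases a) (simp_all add: one_superboolean_def)
  show "(a + b) * c = a * c + b * c" by (cases a; cases b; cases c) simp_all
  show "0 * a = 0" by (simp add: zero_superboolean_def)
  show "a * 0 = 0" by (cases a) (simp_all add: zero_superboolean_def)
  show "(0 :: superboolean) \<noteq> 1" by (simp add: zero_superboolean_def one_superboolean_def)
qed

end

text \<open>
  Dependence of the family of vectors \<open>v i\<close>, \<open>i \<in> I\<close>. The coefficients are restricted
  to $0$ and $1$; the ghost element is not allowed as a coefficient.
\<close>

definition sb_dependent :: "'m::finite set \<Rightarrow> ('m \<Rightarrow> superboolean ^ 'n) \<Rightarrow> bool" where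
  "sb_dependent I v \<longleftrightarrow>
     (\<exists>\<alpha>. (\<forall>i\<in>I. \<alpha> i \<in> {0, 1}) \<and> (\<exists>i\<in>I. \<alpha> i \<noteq> 0) \<and>
          (\<forall>r. (\<Sum>i\<in>I. \<alpha> i *s v i) $ r \<in> {0, SBnu}))"

abbreviation sb_independent :: "'m::finite set \<Rightarrow> ('m \<Rightarrow> superboolean ^ 'n) \<Rightarrow> bool" where
  "sb_independent I v \<equiv> \<not> sb_dependent I v"

definition lattice_matrix :: "superboolean ^ 'a::{finite, bounded_lattice} ^ 'a::{finite, bounded_lattice}" where
  "lattice_matrix = (\<chi> m l. if l \<le> m then 0 else 1)"

definition c_independent :: "'a::{finite, bounded_lattice} set \<Rightarrow> bool" where
  "c_independent X \<longleftrightarrow> sb_independent X (\<lambda>x. column x lattice_matrix)"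

text \<open>
  A maximal strict chain $T = p_0 > p_1 > \dots > p_k = B$, as the list
  $[p_0, \dots, p_k]$ of length $k + 1$.
\<close>

definition is_maximal_chain :: "'a::{finite, bounded_lattice} list \<Rightarrow> bool" where
  "is_maximal_chain ps \<longleftrightarrow>
     ps \<noteq> [] \<and> hd ps = top \<and> last ps = bot \<and> sorted_wrt (>) ps \<and>
     pred_on.maxchain UNIV (<) (set ps)"

text \<open>The list $[Q_1, \dots, Q_k]$; the down-set of \<open>p\<close> is \<open>{..p}\<close>.\<close>

definition chain_partition :: "'a::{finite, bounded_lattice} list \<Rightarrow> 'a set list" where
  "chain_partition ps = map (\<lambda>i. {..ps ! (i - 1)} - {..ps ! i}) [1..<length ps]"

definition partial_cross_section :: "'a set list \<Rightarrow> 'a set \<Rightarrow> bool" where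
  "partial_cross_section Qs X \<longleftrightarrow>
     (\<forall>x\<in>X. \<exists>i<length Qs. x \<in> Qs ! i) \<and>
     (\<forall>x\<in>X. \<forall>y\<in>X. x \<noteq> y \<longrightarrow>
        (\<forall>i<length Qs. \<forall>j<length Qs. x \<in> Qs ! i \<longrightarrow> y \<in> Qs ! j \<longrightarrow> i \<noteq> j))"

end

theory Submission
  imports Defs
begin

text \<open>
  Coefficients \<open>0\<close> and \<open>1\<close>, not all \<open>0\<close>, amount to a nonempty subset \<open>Y\<close> of \<open>X\<close>, and the
  entry in row \<open>m\<close> of the corresponding sum of columns counts, up to the cut-off at two, the
  elements of \<open>Y\<close> that are not below \<open>m\<close>. So \<open>X\<close> is c-independent iff every nonempty
  \<open>Y \<subseteq> X\<close> has an isolating element: some \<open>m\<close> that is above all elements of \<open>Y\<close> but exactly one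
  (\<open>c_independent_iff_isolating\<close>).

  A partial cross section of the partition of a maximal chain can also be described without the
  blocks: \<open>X\<close> avoids the bottom element, and any two of its elements are separated by some \<open>p\<close>
  in the chain, that is, \<open>p\<close> is above one but not the other
  (\<open>partial_cross_section_iff_separated\<close>). It remains to compare the two descriptions.

  If a chain separates the elements of \<open>X\<close>, then the greatest chain element that fails to bound
  \<open>Y\<close> isolates one element of \<open>Y\<close>. Conversely, isolating elements of \<open>X\<close>, of \<open>X\<close> without the
  element isolated first, and so on, need not be comparable, but replacing each by its meet with
  all previous ones turns them into a chain without changing which of the remaining elements lie
  below (\<open>separating_chain_exists\<close>). Enlarging this chain to a maximal one keeps the separation.
\<close>

section \<open>Independence as the existence of isolating elements\<close>

text \<open>Addition in the superboolean semiring counts \<open>0\<close>, \<open>1\<close>, many.\<close>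

lemma of_nat_superboolean_ghost_iff:
  "(of_nat n :: superboolean) \<in> {0, SBnu} \<longleftrightarrow> n \<noteq> 1"
proof -
  have many: "(of_nat (Suc (Suc k)) :: superboolean) = SBnu" for k
    by (induction k) (simp_all add: one_superboolean_def zero_superboolean_def)
  show ?thesis
  proof (cases n)
    case (Suc m)
    then show ?thesis
      using many by (cases m) (auto simp: one_superboolean_def zero_superboolean_def)
  qed simp
qed

lemma column_combination_entry:
  fixes I :: "'a::{finite, bounded_lattice} set"
  assumes "\<forall>i\<in>I. \<alpha> i \<in> {0, 1}"
  shows "(\<Sum>i\<in>I. \<alpha> i *s column i lattice_matrix) $ r
    = of_nat (card {i \<in> I. \<alpha> i \<noteq> 0 \<and> \<not> i \<le> r})"
proof -
  have "(\<Sum>i\<in>I. \<alpha> i *s column i lattice_matrix) $ r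
    = (\<Sum>i\<in>I. if \<alpha> i \<noteq> 0 \<and> \<not> i \<le> r then 1 else 0)"
    using assms
    by (auto simp: column_def lattice_matrix_def vector_scalar_mult_def intro!: sum.cong)
  also have "\<dots> = (\<Sum>i\<in>{i \<in> I. \<alpha> i \<noteq> 0 \<and> \<not> i \<le> r}. 1)"
    by (rule sum.inter_filter [symmetric]) simp
  finally show ?thesis by simp
qed

definition isolates :: "'a::order \<Rightarrow> 'a set \<Rightarrow> bool" where
  "isolates m Y \<longleftrightarrow> (\<exists>!y. y \<in> Y \<and> \<not> y \<le> m)"

lemma isolates_iff_card: "isolates m Y \<longleftrightarrow> card {y \<in> Y. \<not> y \<le> m} = 1"
  unfolding isolates_def One_nat_def card_1_singleton_iff Ex1_def
  by (intro arg_cong [where f = Ex] ext) auto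

lemma c_independent_iff_isolating:
  fixes X :: "'a::{finite, bounded_lattice} set"
  shows "c_independent X \<longleftrightarrow>
    (\<forall>Y. Y \<subseteq> X \<longrightarrow> Y \<noteq> {} \<longrightarrow> (\<exists>m. isolates m Y))"
proof -
  have "sb_dependent X (\<lambda>x. column x lattice_matrix) \<longleftrightarrow>
    (\<exists>Y. Y \<subseteq> X \<and> Y \<noteq> {} \<and> (\<forall>m. \<not> isolates m Y))"
    (is "_ \<longleftrightarrow> ?no_isolating")
  proof
    assume "sb_dependent X (\<lambda>x. column x lattice_matrix)"
    then obtain \<alpha> where \<alpha>: "\<forall>i\<in>X. \<alpha> i \<in> {0, 1}" "\<exists>i\<in>X. \<alpha> i \<noteq> 0"
      and sum: "\<And>r. (\<Sum>i\<in>X. \<alpha> i *s column i lattice_matrix) $ r \<in> {0, SBnu}"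
      unfolding sb_dependent_def by blast
    have "card {i \<in> X. \<alpha> i \<noteq> 0 \<and> \<not> i \<le> r} \<noteq> 1" for r
      using sum [of r]
      unfolding column_combination_entry [OF \<alpha>(1)] of_nat_superboolean_ghost_iff .
    then have "\<not> isolates r {i \<in> X. \<alpha> i \<noteq> 0}" for r
      by (simp add: isolates_iff_card conj_assoc)
    with \<alpha>(2) show ?no_isolating
      by (intro exI [of _ "{i \<in> X. \<alpha> i \<noteq> 0}"]) auto
  next
    assume ?no_isolating
    then obtain Y where Y: "Y \<subseteq> X" "Y \<noteq> {}" "\<And>m. \<not> isolates m Y"
      by blast
    define \<alpha> :: "'a \<Rightarrow> superboolean" where "\<alpha> = (\<lambda>i. if i \<in> Y then 1 else 0)"
    have \<alpha>: "\<forall>i\<in>X. \<alpha> i \<in> {0, 1}" by (simp add: \<alpha>_def)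
    have "{i \<in> X. \<alpha> i \<noteq> 0 \<and> \<not> i \<le> r} = {y \<in> Y. \<not> y \<le> r}" for r
      using Y(1) by (auto simp: \<alpha>_def)
    then have "(\<Sum>i\<in>X. \<alpha> i *s column i lattice_matrix) $ r \<in> {0, SBnu}" for r
      unfolding column_combination_entry [OF \<alpha>] of_nat_superboolean_ghost_iff
      using Y(3) by (simp add: isolates_iff_card)
    moreover have "\<exists>i\<in>X. \<alpha> i \<noteq> 0" using Y(1,2) by (auto simp: \<alpha>_def)
    ultimately show "sb_dependent X (\<lambda>x. column x lattice_matrix)"
      using \<alpha> unfolding sb_dependent_def by blast
  qed
  then show ?thesis
    unfolding c_independent_def by blast
qed

section \<open>Cross sections as separation by a chain\<close>

lemma nth_antimono_if_descending:
  fixes ps :: "'a::order list"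
  assumes "sorted_wrt (>) ps" "i \<le> j" "j < length ps"
  shows "ps ! j \<le> ps ! i"
  using sorted_wrt_nth_less [OF assms(1), of i j] assms(2,3) by (cases "i = j") auto

definition separates :: "'a::order set \<Rightarrow> 'a set \<Rightarrow> bool" where
  "separates C X \<longleftrightarrow>
     (\<forall>x\<in>X. \<forall>y\<in>X. x \<noteq> y \<longrightarrow> (\<exists>p\<in>C. \<not> (x \<le> p \<longleftrightarrow> y \<le> p)))"

lemma length_chain_partition [simp]: "length (chain_partition ps) = length ps - 1"
  by (simp add: chain_partition_def)

lemma nth_chain_partition:
  "i < length ps - 1 \<Longrightarrow> chain_partition ps ! i = {..ps ! i} - {..ps ! Suc i}"
  by (simp add: chain_partition_def)

lemma in_some_block_iff:
  fixes ps :: "'a::{finite, bounded_lattice} list"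
  assumes ne: "ps \<noteq> []" and "hd ps = top" and "last ps = bot"
  shows "(\<exists>i<length (chain_partition ps). x \<in> chain_partition ps ! i) \<longleftrightarrow> x \<noteq> bot"
proof
  assume "x \<noteq> bot"
  let ?P = "\<lambda>i. \<not> x \<le> ps ! i"
  have "?P (length ps - 1)"
    using assms \<open>x \<noteq> bot\<close> by (auto simp: last_conv_nth bot_unique)
  moreover have "\<not> ?P 0" using assms by (simp add: hd_conv_nth)
  \<comment> \<open>The block of \<open>x\<close> ends at the first chain element that is not above \<open>x\<close>.\<close>
  ultimately obtain k where "k < length ps - 1" "\<not> ?P k" "?P (Suc k)"
    using ex_least_nat_less [of ?P "length ps - 1"] by blast
  then show "\<exists>i<length (chain_partition ps). x \<in> chain_partition ps ! i"
    by (intro exI [of _ k]) (simp add: nth_chain_partition)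
qed (auto simp: nth_chain_partition)

text \<open>
  Which chain elements are above \<open>x\<close> depends only on the block of \<open>x\<close> and determines it:
  for \<open>x\<close> in \<open>{..p\<^sub>i} - {..p\<^sub>i\<^sub>+\<^sub>1}\<close> they are exactly \<open>p\<^sub>0, \<dots>, p\<^sub>i\<close>.
\<close>

lemma partial_cross_section_iff_separated:
  fixes ps :: "'a::{finite, bounded_lattice} list"
  assumes ne: "ps \<noteq> []" and ends: "hd ps = top" "last ps = bot"
    and desc: "sorted_wrt (>) ps"
  shows "partial_cross_section (chain_partition ps) X \<longleftrightarrow>
    bot \<notin> X \<and> separates (set ps) X"
proof -
  let ?n = "length (chain_partition ps)" and ?Q = "\<lambda>i. chain_partition ps ! i"
  note anti = nth_antimono_if_descending [OF desc]
  have later: "y \<le> ps ! Suc i \<and> \<not> x \<le> ps ! Suc i"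
    if "i < j" "j < ?n" "x \<in> ?Q i" "y \<in> ?Q j" for i j x y
    using that anti [of "Suc i" j] by (auto simp: nth_chain_partition intro: order_trans)
  have same: "x \<le> p"
    if "i < ?n" "x \<in> ?Q i" "y \<in> ?Q i" "p \<in> set ps" "y \<le> p" for i x y p
  proof -
    obtain j where j: "j < length ps" "p = ps ! j"
      using \<open>p \<in> set ps\<close> by (auto simp: in_set_conv_nth)
    have "j \<le> i"
    proof (rule ccontr)
      assume "\<not> j \<le> i"
      then have "y \<le> ps ! Suc i" using anti [of "Suc i" j] j that(5) by (auto intro: order_trans)
      then show False using that(1,3) by (simp add: nth_chain_partition)
    qed
    then show ?thesis
      using anti [of j i] j that(1,2) by (auto simp: nth_chain_partition intro: order_trans)
  qed
  have blocks: "(\<forall>i<?n. \<forall>j<?n. x \<in> ?Q i \<longrightarrow> y \<in> ?Q j \<longrightarrow> i \<noteq> j) \<longleftrightarrow>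
      (\<exists>p\<in>set ps. \<not> (x \<le> p \<longleftrightarrow> y \<le> p))" (is "?distinct \<longleftrightarrow> ?sep")
    if "x \<noteq> bot" "y \<noteq> bot" for x y
  proof
    assume ?distinct
    obtain i j where ij: "i < ?n" "x \<in> ?Q i" "j < ?n" "y \<in> ?Q j"
      using in_some_block_iff [OF ne ends] \<open>x \<noteq> bot\<close> \<open>y \<noteq> bot\<close> by metis
    have "ps ! Suc i \<in> set ps" "ps ! Suc j \<in> set ps" using ij(1,3) by auto
    moreover have "i < j \<or> j < i" using \<open>?distinct\<close> ij by (meson linorder_neqE_nat)
    ultimately show ?sep using later ij by metis
  next
    assume ?sep then show ?distinct using same by metis
  qed
  have covered: "(\<forall>x\<in>X. \<exists>i<?n. x \<in> ?Q i) \<longleftrightarrow> bot \<notin> X"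
    unfolding in_some_block_iff [OF ne ends] by blast
  show ?thesis
    unfolding partial_cross_section_def covered separates_def
    by (intro conj_cong ball_cong imp_cong refl blocks) auto
qed

section \<open>Separating chains and isolating elements\<close>

abbreviation order_chain :: "'a::order set \<Rightarrow> bool" where
  "order_chain \<equiv> pred_on.chain UNIV (<)"

lemma order_chain_iff: "order_chain C \<longleftrightarrow> (\<forall>x\<in>C. \<forall>y\<in>C. x \<le> y \<or> y \<le> x)"
  by (auto simp: pred_on.chain_def order.order_iff_strict)

lemma isolating_if_separates:
  fixes C :: "'a::{finite, bounded_lattice} set"
  assumes chain: "order_chain C" and "bot \<in> C" and sep: "separates C Y"
    and "bot \<notin> Y" and "Y \<noteq> {}"
  shows "\<exists>m. isolates m Y"
proof -
  let ?F = "{p \<in> C. \<exists>y\<in>Y. \<not> y \<le> p}"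
  have "bot \<in> ?F" using assms by (auto simp: bot_unique)
  then obtain m where m: "m \<in> ?F" and max: "\<And>p. p \<in> ?F \<Longrightarrow> m \<le> p \<Longrightarrow> m = p"
    using finite_has_maximal [of ?F] by auto
  \<comment> \<open>If \<open>m\<close> missed two elements, the element of \<open>C\<close> separating them would lie strictly above
    \<open>m\<close> and still miss one of them.\<close>
  have no_two: "\<not> y \<le> p"
    if "x \<in> Y" "y \<in> Y" "\<not> x \<le> m" "\<not> y \<le> m" "p \<in> C" "\<not> x \<le> p" for x y p
  proof
    assume "y \<le> p"
    then have "m \<le> p"
      using chain that m order_trans [of y p m] by (auto simp: order_chain_iff)
    then have "m = p" using max that by blast
    then show False using \<open>y \<le> p\<close> that by simp
  qed
  have "x = y" if "x \<in> Y" "y \<in> Y" "\<not> x \<le> m" "\<not> y \<le> m" for x y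
    using sep no_two that unfolding separates_def by metis
  then have "isolates m Y" using m unfolding isolates_def by blast
  then show ?thesis by blast
qed

text \<open>
  Once \<open>m\<close> isolates \<open>x\<close> in \<open>X\<close>, all other elements of \<open>X\<close> are below \<open>m\<close>, so a chain separating
  them can be pushed below \<open>m\<close> by meets and still separates them, while \<open>m\<close> itself
  splits off \<open>x\<close>.
\<close>

lemma separating_chain_exists:
  fixes X :: "'a::{finite, lattice} set"
  assumes "\<And>Y. Y \<subseteq> X \<Longrightarrow> Y \<noteq> {} \<Longrightarrow> \<exists>m. isolates m Y"
  shows "\<exists>C. order_chain C \<and> separates C X"
  using finite [of X] assms
proof (induction X rule: finite_psubset_induct)
  case (psubset X)
  show ?case
  proof (cases "X = {}")
    case True
    then show ?thesis by (intro exI [of _ "{}"]) (simp add: separates_def order_chain_iff)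
  next
    case False
    then obtain m x where x: "x \<in> X" "\<not> x \<le> m"
      and rest: "\<And>y. y \<in> X \<Longrightarrow> y \<noteq> x \<Longrightarrow> y \<le> m"
      using psubset.prems [of X] unfolding isolates_def by blast
    have "X - {x} \<subset> X" using x(1) by blast
    then obtain C where C: "order_chain C" "separates C (X - {x})"
      using psubset.IH [of "X - {x}"] psubset.prems by (metis psubset_imp_subset subset_trans)
    let ?C = "insert m (inf m ` C)"
    have "inf m c \<le> inf m d \<or> inf m d \<le> inf m c" if "c \<in> C" "d \<in> C" for c d
      using C(1) that inf_mono [OF order_refl [of m]] unfolding order_chain_iff by blast
    then have "order_chain ?C"
      unfolding order_chain_iff by (simp del: le_inf_iff)
    moreover have "separates ?C X"
      unfolding separates_def
    proof (intro ballI impI)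
      fix y z assume yz: "y \<in> X" "z \<in> X" "y \<noteq> z"
      show "\<exists>p\<in>?C. \<not> (y \<le> p \<longleftrightarrow> z \<le> p)"
      proof (cases "y = x \<or> z = x")
        case True
        then show ?thesis using yz x rest by (intro bexI [of _ m]) auto
      next
        case False
        then obtain p where "p \<in> C" "\<not> (y \<le> p \<longleftrightarrow> z \<le> p)"
          using C(2) yz unfolding separates_def by blast
        then show ?thesis using False yz rest by (intro bexI [of _ "inf m p"]) auto
      qed
    qed
    ultimately show ?thesis by blast
  qed
qed

section \<open>Listing maximal chains\<close>

lemma descending_list_of_chain:
  fixes C :: "'a::order set"
  assumes "finite C" "order_chain C"
  shows "\<exists>ps. set ps = C \<and> sorted_wrt (>) ps"
  using assms
proof (induction C rule: finite_psubset_induct)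
  case (psubset C)
  show ?case
  proof (cases "C = {}")
    case False
    then obtain t where t: "t \<in> C" "\<And>y. y \<in> C \<Longrightarrow> t \<le> y \<Longrightarrow> t = y"
      using finite_has_maximal [OF psubset.hyps] by blast
    have "C - {t} \<subset> C" "order_chain (C - {t})"
      using t(1) psubset.prems by (auto simp: order_chain_iff)
    then obtain ps where ps: "set ps = C - {t}" "sorted_wrt (>) ps"
      using psubset.IH by blast
    have "y < t" if "y \<in> C - {t}" for y
      using that t psubset.prems unfolding order_chain_iff by (metis DiffD1 DiffD2 insertI1 less_le)
    with ps t(1) show ?thesis by (intro exI [of _ "t # ps"]) auto
  qed simp
qed

text \<open>
  The list runs from top to bottom because a maximal chain contains every element that is
  comparable to all of its members, in particular both bounds of the lattice.
\<close>

lemma maximal_chain_list_extending: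
  fixes C :: "'a::{finite, bounded_lattice} set"
  assumes "order_chain C"
  shows "\<exists>ps. is_maximal_chain ps \<and> C \<subseteq> set ps"
proof -
  obtain M where M: "order_chain M" "C \<subseteq> M"
    and max: "\<And>D. order_chain D \<Longrightarrow> M \<subseteq> D \<Longrightarrow> M = D"
    using finite_has_maximal2 [of "{D. order_chain D}" C] assms by auto
  have maxchain: "pred_on.maxchain UNIV (<) M"
    using M(1) max by (auto simp: pred_on.maxchain_def)
  have "order_chain (insert top M)" "order_chain (insert bot M)"
    using M(1) by (auto simp: order_chain_iff)
  then have bounds: "top \<in> M" "bot \<in> M" using max by blast+
  obtain ps where ps: "set ps = M" "sorted_wrt (>) ps"
    using descending_list_of_chain [OF finite M(1)] by blast
  have ne: "ps \<noteq> []" using ps bounds by auto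
  note anti = nth_antimono_if_descending [OF ps(2)]
  have "x \<le> hd ps" "last ps \<le> x" if "x \<in> M" for x
  proof -
    obtain i where "i < length ps" "x = ps ! i"
      using \<open>x \<in> M\<close> ps(1) by (auto simp: in_set_conv_nth)
    then show "x \<le> hd ps" "last ps \<le> x"
      using ne anti [of 0 i] anti [of i "length ps - 1"] by (auto simp: hd_conv_nth last_conv_nth)
  qed
  then have "top \<le> hd ps" "last ps \<le> bot" using bounds by blast+
  then have "hd ps = top" "last ps = bot" by (simp_all add: top_unique bot_unique)
  then show ?thesis
    using ps ne maxchain M(2) unfolding is_maximal_chain_def by blast
qed

section \<open>The characterization of c-independent sets\<close>

theorem theorem4p15:
  fixes X :: "'a::{finite, bounded_lattice} set"
  shows "c_independent X \<longleftrightarrow>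
    (\<exists>ps :: 'a list. is_maximal_chain ps \<and> partial_cross_section (chain_partition ps) X)"
proof
  assume "c_independent X"
  then have iso: "\<exists>m. isolates m Y" if "Y \<subseteq> X" "Y \<noteq> {}" for Y
    using that c_independent_iff_isolating by blast
  \<comment> \<open>No element isolates the bottom element in its singleton.\<close>
  have "bot \<notin> X" using iso [of "{bot}"] by (auto simp: isolates_def)
  obtain C where C: "order_chain C" "separates C X"
    using separating_chain_exists [of X] iso by blast
  obtain ps where ps: "is_maximal_chain ps" "C \<subseteq> set ps"
    using maximal_chain_list_extending [OF C(1)] by blast
  have "separates (set ps) X" using C(2) ps(2) unfolding separates_def by blast
  with \<open>bot \<notin> X\<close> ps(1)
  show "\<exists>ps. is_maximal_chain ps \<and> partial_cross_section (chain_partition ps) X"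
    using partial_cross_section_iff_separated unfolding is_maximal_chain_def by blast
next
  assume "\<exists>ps. is_maximal_chain ps \<and> partial_cross_section (chain_partition ps) X"
  then obtain ps where ps: "is_maximal_chain ps"
    and "partial_cross_section (chain_partition ps) X" by blast
  then have X: "bot \<notin> X" "separates (set ps) X"
    using partial_cross_section_iff_separated unfolding is_maximal_chain_def by blast+
  have chain: "order_chain (set ps)"
    using ps by (simp add: is_maximal_chain_def pred_on.maxchain_def)
  have bot: "bot \<in> set ps"
    using ps last_in_set unfolding is_maximal_chain_def by metis
  have "\<exists>m. isolates m Y" if "Y \<subseteq> X" "Y \<noteq> {}" for Y
  proof (rule isolating_if_separates [OF chain bot])
    show "separates (set ps) Y" using X(2) that(1) unfolding separates_def by blast
  qed (use X(1) that in auto)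
  then show "c_independent X" using c_independent_iff_isolating by blast
qed

end
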